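(* Let $G$ be a bipartite graph with sides $A$ and $B$, both infinite, such that $G$ is a dHp graph and every vertex of $B$ has finite degree in $G$. Then there exists a collection of pairwise vertex-disjoint 2-regular subgraphs of $G$ that covers all vertices of $A$.
   Context: For $X\subseteq V(G)$ with $|X|\ge 2$, $N^2(X)$ denotes the set of vertices of $G$ having at least two neighbours in $X$. A bipartite graph $G$ with sides $A$ and $B$ is a dHp graph if $|A|\ge 2$ and $|N^2(X)|\ge |X|$ for every $X\subseteq A$ with $|X|\ge 2$. A 2-regular subgraph is a subgraph in which every vertex has degree exactly $2$. A collection of subgraphs covers $A$ if every vertex of $A$ lies in one of them. *)

theory Defs
  imports Main "HOL-Library.Equipollence"
begin

record 'a graph =
  verts :: "'a set"
  edges :: "'a set set"

definition simple_graph :: "'a graph \<Rightarrow> bool" where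
  "simple_graph G \<longleftrightarrow> (\<forall>e\<in>edges G. e \<subseteq> verts G \<and> card e = 2)"

definition neighbours :: "'a graph \<Rightarrow> 'a \<Rightarrow> 'a set" where
  "neighbours G v = {u. {u, v} \<in> edges G}"

definition bipartite_graph :: "'a graph \<Rightarrow> 'a set \<Rightarrow> 'a set \<Rightarrow> bool" where
  "bipartite_graph G A B \<longleftrightarrow> simple_graph G \<and> verts G = A \<union> B \<and> A \<inter> B = {} \<and>
     (\<forall>e\<in>edges G. \<exists>a\<in>A. \<exists>b\<in>B. e = {a, b})"

text \<open>Not phrased with \<^const>\<open>card\<close>, which is 0 on infinite sets.\<close>
definition at_least_two :: "'a set \<Rightarrow> bool" where
  "at_least_two S \<longleftrightarrow> (\<exists>x\<in>S. \<exists>y\<in>S. x \<noteq> y)"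

definition N2 :: "'a graph \<Rightarrow> 'a set \<Rightarrow> 'a set" where
  "N2 G X = {v \<in> verts G. at_least_two (neighbours G v \<inter> X)}"

text \<open>The set \<open>X\<close> may be infinite, so sizes are compared as cardinals, by \<open>\<lesssim>\<close>.\<close>
definition dHp_graph :: "'a graph \<Rightarrow> 'a set \<Rightarrow> 'a set \<Rightarrow> bool" where
  "dHp_graph G A B \<longleftrightarrow> bipartite_graph G A B \<and> at_least_two A \<and>
     (\<forall>X. X \<subseteq> A \<and> at_least_two X \<longrightarrow> X \<lesssim> N2 G X)"

definition subgraph_of :: "'a graph \<Rightarrow> 'a graph \<Rightarrow> bool" where
  "subgraph_of H G \<longleftrightarrow> simple_graph H \<and> verts H \<subseteq> verts G \<and> edges H \<subseteq> edges G"

text \<open>Infinite graphs are allowed, so a component is a finite cycle or a two-way infinite path.\<close>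
definition two_regular :: "'a graph \<Rightarrow> bool" where
  "two_regular H \<longleftrightarrow> (\<forall>v\<in>verts H. card (neighbours H v) = 2)"

definition covers :: "'a graph set \<Rightarrow> 'a set \<Rightarrow> bool" where
  "covers \<H> A \<longleftrightarrow> (\<forall>a\<in>A. \<exists>H\<in>\<H>. a \<in> verts H)"

end

theory Submission
  imports Defs
begin

text \<open>
  Applied to two-element sets, the double Hall property says that any two vertices of \<open>A\<close>
  have two common neighbours. Well-order \<open>A\<close> by its cardinality and cover its vertices one
  after the other by disjoint 4-cycles: at each stage the set \<open>U\<close> of vertices already used is
  smaller than \<open>A\<close>, and, as the vertices of \<open>B\<close> have finite degree, so is \<open>U\<close> together with
  the set of neighbours of \<open>U \<inter> B\<close>. Hence for an uncovered \<open>a\<close> there is an \<open>a'\<close> in \<open>A\<close>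
  outside both sets, and no common neighbour of \<open>a\<close> and \<open>a'\<close> has been used.
\<close>

unbundle cardinal_syntax

lemma card_of_finite_ordLess_infinite:
  assumes "finite X" "infinite A"
  shows "|X| <o |A|"
  using assms
  by (intro finite_ordLess_infinite[OF card_of_Well_order card_of_Well_order])
     (simp_all only: Field_card_of not_False_eq_True)

text \<open>Since each \<open>F i\<close> is finite, the union is finite when \<open>I\<close> is,
  and has size at most \<open>|I|\<close> when \<open>I\<close> is infinite. Regularity of the
  cardinal \<open>|A|\<close> therefore does not enter.\<close>

lemma card_of_UN_finite_ordLess:
  assumes "infinite A" "|I| <o |A|" "\<And>i. i \<in> I \<Longrightarrow> finite (F i)"
  shows "|\<Union>i\<in>I. F i| <o |A|"
proof (cases "finite I")
  case True
  then show ?thesis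
    using assms by (intro card_of_finite_ordLess_infinite) auto
next
  case False
  have "|\<Union>i\<in>I. F i| \<le>o |I|"
    using False assms(3)
    by (intro card_of_UNION_ordLeq_infinite)
       (auto intro: ordLess_imp_ordLeq card_of_mono1 card_of_finite_ordLess_infinite)
  then show ?thesis
    using assms(2) ordLeq_ordLess_trans by blast
qed

definition four_cycle :: "'a \<Rightarrow> 'a \<Rightarrow> 'a \<Rightarrow> 'a \<Rightarrow> 'a graph" where
  "four_cycle a b c d = \<lparr>verts = {a, b, c, d}, edges = {{a, b}, {b, c}, {c, d}, {d, a}}\<rparr>"

lemma two_regular_four_cycle:
  assumes "distinct [a, b, c, d]"
  shows "two_regular (four_cycle a b c d)"
proof -
  have "neighbours (four_cycle a b c d) a = {b, d}" "neighbours (four_cycle a b c d) c = {b, d}"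
    "neighbours (four_cycle a b c d) b = {a, c}" "neighbours (four_cycle a b c d) d = {a, c}"
    using assms by (auto simp: neighbours_def four_cycle_def doubleton_eq_iff)
  then show ?thesis
    using assms by (auto simp: two_regular_def four_cycle_def)
qed

lemma subgraph_of_four_cycle:
  assumes "simple_graph G" "edges (four_cycle a b c d) \<subseteq> edges G"
  shows "subgraph_of (four_cycle a b c d) G"
  using assms by (force simp: subgraph_of_def simple_graph_def four_cycle_def)

lemma bipartite_edge_sides:
  assumes "bipartite_graph G A B" "{b, a} \<in> edges G" "a \<in> A"
  shows "b \<in> B"
  using assms unfolding bipartite_graph_def by (metis disjoint_iff doubleton_eq_iff)

lemma dHp_two_common_neighbours:
  assumes "dHp_graph G A B" "a \<in> A" "c \<in> A" "a \<noteq> c"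
  obtains b d where "b \<noteq> d" "{b, a} \<in> edges G" "{b, c} \<in> edges G"
    "{d, a} \<in> edges G" "{d, c} \<in> edges G"
proof -
  have "{a, c} \<subseteq> A" "at_least_two {a, c}"
    using assms by (auto simp: at_least_two_def)
  then have "{a, c} \<lesssim> N2 G {a, c}"
    using assms(1) unfolding dHp_graph_def by blast
  then obtain f where f: "inj_on f {a, c}" "f ` {a, c} \<subseteq> N2 G {a, c}"
    by (auto simp: lepoll_def)
  \<comment> \<open>Two distinct neighbours inside a two-element set exhaust it. The injection
    \<open>f\<close> then supplies two different common neighbours, \<open>f a\<close> and
    \<open>f c\<close>.\<close>
  have "{v, a} \<in> edges G \<and> {v, c} \<in> edges G" if "v \<in> N2 G {a, c}" for v
    using that by (auto simp: N2_def at_least_two_def neighbours_def insert_commute)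
  with f assms(4) show ?thesis
    by (intro that[of "f a" "f c"]) (auto simp: inj_on_def)
qed

lemma exists_four_cycle_avoiding:
  assumes "infinite A" "dHp_graph G A B" "\<forall>b\<in>B. finite (neighbours G b)"
    and "|U| <o |A|" "a \<in> A" "a \<notin> U"
  obtains H where "subgraph_of H G" "two_regular H" "finite (verts H)" "disjnt (verts H) U"
    "a \<in> verts H"
proof -
  have bip: "bipartite_graph G A B"
    using assms(2) by (simp add: dHp_graph_def)
  define W where "W = (\<Union>u\<in>U. insert u (if u \<in> B then neighbours G u else {}))"
  have "|W| <o |A|"
    unfolding W_def using assms by (intro card_of_UN_finite_ordLess) auto
  moreover have "|{a}| <o |A|"
    using assms(1) by (intro card_of_finite_ordLess_infinite) auto
  ultimately have "|insert a W| <o |A|"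
    using card_of_Un_ordLess_infinite[OF assms(1), of "{a}" W] by simp
  then have "\<not> A \<subseteq> insert a W"
    using card_of_mono1 not_ordLess_ordLeq by blast
  then obtain c where c: "c \<in> A" "c \<noteq> a" "c \<notin> W"
    by blast
  obtain b d where bd: "b \<noteq> d" "{b, a} \<in> edges G" "{b, c} \<in> edges G"
    "{d, a} \<in> edges G" "{d, c} \<in> edges G"
    using dHp_two_common_neighbours[OF assms(2,5) c(1)] c(2) by metis
  have "b \<in> B" "d \<in> B"
    using bipartite_edge_sides[OF bip] bd assms(5) by blast+
  moreover have "A \<inter> B = {}" "simple_graph G"
    using bip by (auto simp: bipartite_graph_def)
  ultimately have dist: "distinct [a, b, c, d]"
    using bd(1) c assms(5) by auto
  \<comment> \<open>Otherwise \<open>c\<close> would be a neighbour of a vertex of \<open>U\<close>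
    in \<open>B\<close>, and so would lie in \<open>W\<close>.\<close>
  have "u \<notin> U" if "u \<in> B" "{u, c} \<in> edges G" for u
    using that c(3) by (auto simp: W_def neighbours_def insert_commute)
  then have "b \<notin> U" "d \<notin> U"
    using \<open>b \<in> B\<close> \<open>d \<in> B\<close> bd by blast+
  moreover have "c \<notin> U"
    using c(3) by (auto simp: W_def)
  ultimately have "disjnt (verts (four_cycle a b c d)) U"
    using assms(6) by (simp add: four_cycle_def)
  moreover have "subgraph_of (four_cycle a b c d) G"
    using \<open>simple_graph G\<close> bd
    by (intro subgraph_of_four_cycle) (auto simp: four_cycle_def insert_commute)
  ultimately show ?thesis
    using two_regular_four_cycle[OF dist]
    by (intro that[of "four_cycle a b c d"]) (auto simp: four_cycle_def)
qed

theorem theorem2p15: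
  fixes G :: "'a graph" and A B :: "'a set"
  assumes "bipartite_graph G A B"
    and "infinite A" and "infinite B"
    and "dHp_graph G A B"
    and "\<forall>b\<in>B. finite (neighbours G b)"
  shows "\<exists>\<H>. (\<forall>H\<in>\<H>. subgraph_of H G \<and> two_regular H)
    \<and> pairwise (\<lambda>H K. disjnt (verts H) (verts K)) \<H>
    \<and> covers \<H> A"
proof -
  let ?R = "|A| - Id"
  define used where "used f x = (\<Union>y\<in>underS |A| x. verts (f y))" for f :: "'a \<Rightarrow> 'a graph" and x
  \<comment> \<open>Requirement on the graph \<open>H\<close> chosen at stage \<open>x\<close>,
    given the earlier choices \<open>f\<close>. The last conjunct lets \<open>H\<close> miss
    \<open>x\<close> if an earlier graph contains it; finiteness keeps \<open>used\<close> smaller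
    than \<open>A\<close> at later stages.\<close>
  define P where "P f x H \<longleftrightarrow> (x \<in> A \<longrightarrow> subgraph_of H G \<and> two_regular H \<and> finite (verts H) \<and>
    disjnt (verts H) (used f x) \<and> x \<in> used f x \<union> verts H)" for f x H
  have wo: "Well_order |A|" "Field |A| = A"
    by (rule card_of_Well_order, rule Field_card_of)
  have under: "y \<in> underS |A| x \<longleftrightarrow> (y, x) \<in> ?R" for x y
    by (auto simp: underS_def)
  have under_A: "y \<in> A" if "y \<in> underS |A| x" for x y
    using that wo(2) by (auto simp: underS_def Field_def)
  have "\<exists>f. \<forall>x. P f x (f x)"
  \<comment> \<open>Well-founded recursion with a choice at each stage: \<open>P f x\<close> may
    depend on \<open>f\<close> only below \<open>x\<close>, and a suitable value must exist whenever
    all earlier ones are suitable.\<close>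
  proof (rule dependent_wf_choice)
    show "wf ?R"
      using wo(1) by (simp add: well_order_on_def)
    show "P f x H = P g x H" if "\<And>z. (z, x) \<in> ?R \<Longrightarrow> f z = g z" for f g x H
    proof -
      have "used f x = used g x"
        unfolding used_def using that under by (intro SUP_cong) auto
      then show ?thesis
        by (simp add: P_def)
    qed
    show "\<exists>H. P f x H" if IH: "\<And>y. (y, x) \<in> ?R \<Longrightarrow> P f y (f y)" for x f
    proof (cases "x \<in> A \<and> x \<notin> used f x")
      case True
      have "finite (verts (f y))" if "y \<in> underS |A| x" for y
        using IH that under under_A unfolding P_def by blast
      \<comment> \<open>\<open>|A|\<close> is a cardinal order, so its proper initial segments are
        strictly smaller than \<open>A\<close>.\<close>
      moreover have "|underS |A| x| <o |A|"
        using True card_of_underS[OF card_of_Card_order] wo(2) by metis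
      ultimately have "|used f x| <o |A|"
        unfolding used_def using assms(2) by (intro card_of_UN_finite_ordLess)
      then show ?thesis
        using True exists_four_cycle_avoiding[OF assms(2,4,5)] unfolding P_def by (metis UnCI)
    next
      case False
      \<comment> \<open>With nothing to cover at this stage, the empty graph serves: it is vacuously
        2-regular and disjoint from everything.\<close>
      then have "P f x \<lparr>verts = {}, edges = {}\<rparr>"
        by (auto simp: P_def subgraph_of_def simple_graph_def two_regular_def)
      then show ?thesis ..
    qed
  qed
  then obtain f where f: "\<And>x. P f x (f x)"
    by blast
  have disj: "disjnt (verts (f y)) (verts (f x))" if "x \<in> A" "(y, x) \<in> ?R" for x y
    using f[of x] that under unfolding P_def used_def disjnt_def by blast
  have total: "(x, y) \<in> ?R \<or> (y, x) \<in> ?R" if "x \<in> A" "y \<in> A" "x \<noteq> y" for x y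
    using that wo by (auto simp: well_order_on_def linear_order_on_def total_on_def)
  have "subgraph_of (f x) G \<and> two_regular (f x)" if "x \<in> A" for x
    using f[of x] that by (simp add: P_def)
  \<comment> \<open>Different graphs in the image have different indices, and the later of the two
    indices yields disjointness. The empty graph may be chosen repeatedly, but it is a single member
    of the image.\<close>
  moreover have "pairwise (\<lambda>H K. disjnt (verts H) (verts K)) (f ` A)"
    unfolding pairwise_def using disj total by (metis (no_types, lifting) disjnt_sym imageE)
  moreover have "covers (f ` A) A"
    unfolding covers_def
  proof
    fix a
    assume "a \<in> A"
    then have "a \<in> verts (f a) \<or> (\<exists>y\<in>A. a \<in> verts (f y))"
      using f[of a] under_A unfolding P_def used_def by blast
    then show "\<exists>H\<in>f ` A. a \<in> verts H"
      using \<open>a \<in> A\<close> by blast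
  qed
  ultimately show ?thesis
    by blast
qed

end
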